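(* There exists a $3$-$(12,4,3)$ design $\mathcal{M}$ on $12$ vertices with the following properties: (a) every set of $5$ vertices spans either $0$ or exactly $2$ hyperedges; (b) $\mathcal{M}$ has $165$ hyperedges; (c) $\mathcal{M}$ is $3$-transitive, and its automorphism group has a subgroup isomorphic to the Mathieu group $M_{11}$.
   Context: A set $X$ of vertices spans a hyperedge $A$ if $A \subseteq X$. A $3$-$(v,4,\lambda)$ design is a $4$-uniform hypergraph on $v$ vertices in which every set of $3$ vertices is contained in exactly $\lambda$ hyperedges. A hypergraph is $3$-transitive if its automorphism group acts transitively on ordered triples of distinct vertices. *)

theory Defs
  imports "HOL-Algebra.Sym_Groups" "HOL-Algebra.Generated_Groups"
begin

text \<open>A hypergraph is given by its vertex set \<open>V\<close> and its set of hyperedges \<open>E\<close>.\<close>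

definition uniform_hypergraph :: "nat \<Rightarrow> 'a set \<Rightarrow> 'a set set \<Rightarrow> bool"
  where "uniform_hypergraph k V E \<longleftrightarrow> finite V \<and> (\<forall>A\<in>E. A \<subseteq> V \<and> card A = k)"

definition spanned :: "'a set set \<Rightarrow> 'a set \<Rightarrow> 'a set set"
  where "spanned E X = {A \<in> E. A \<subseteq> X}"

definition is_design :: "nat \<Rightarrow> nat \<Rightarrow> nat \<Rightarrow> nat \<Rightarrow> 'a set \<Rightarrow> 'a set set \<Rightarrow> bool"
  where "is_design t v k l V E \<longleftrightarrow>
    uniform_hypergraph k V E \<and> card V = v \<and>
    (\<forall>T. T \<subseteq> V \<and> card T = t \<longrightarrow> card {A \<in> E. T \<subseteq> A} = l)"

definition aut_group :: "'a set \<Rightarrow> 'a set set \<Rightarrow> ('a \<Rightarrow> 'a) monoid"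
  where "aut_group V E =
    \<lparr> carrier = {p. p permutes V \<and> (\<forall>A. A \<subseteq> V \<longrightarrow> (p ` A \<in> E \<longleftrightarrow> A \<in> E))},
      mult = (\<circ>), one = id \<rparr>"

definition three_transitive :: "'a set \<Rightarrow> 'a set set \<Rightarrow> bool"
  where "three_transitive V E \<longleftrightarrow>
    (\<forall>x\<in>V. \<forall>y\<in>V. \<forall>z\<in>V. \<forall>x'\<in>V. \<forall>y'\<in>V. \<forall>z'\<in>V.
       distinct [x, y, z] \<longrightarrow> distinct [x', y', z'] \<longrightarrow>
       (\<exists>p \<in> carrier (aut_group V E). p x = x' \<and> p y = y' \<and> p z = z'))"

text \<open>
  The Mathieu group \<open>M\<^sub>1\<^sub>1\<close> as a permutation group of degree 11,
  with its usual generators \<open>(1 2 3 4 5 6 7 8 9 10 11)\<close> and \<open>(3 7 11 8)(4 10 5 6)\<close>.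
  It has order 7920 and is sharply 4-transitive on \<open>{1..11}\<close>.
\<close>

definition M11 :: "(nat \<Rightarrow> nat) monoid"
  where "M11 = sym_group 11
    \<lparr> carrier := generate (sym_group 11)
        {cycle_of_list [1, 2, 3, 4, 5, 6, 7, 8, 9, 10, 11],
         cycle_of_list [3, 7, 11, 8] \<circ> cycle_of_list [4, 10, 5, 6]} \<rparr>"

lemma aut_group_is_group: "group (aut_group V E)"
proof (rule groupI)
  fix p assume p: "p \<in> carrier (aut_group V E)"
  then have pV: "p permutes V" and pE: "\<And>A. A \<subseteq> V \<Longrightarrow> p ` A \<in> E \<longleftrightarrow> A \<in> E"
    by (auto simp: aut_group_def)
  have iV: "inv' p permutes V"
    using pV by (rule permutes_inv)
  have "inv' p ` A \<in> E \<longleftrightarrow> A \<in> E" if "A \<subseteq> V" for A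
  proof -
    have "inv' p ` A \<subseteq> V"
      using iV that permutes_image by blast
    moreover have "p ` inv' p ` A = A"
      using pV by (simp add: image_comp permutes_inv_o)
    ultimately show ?thesis
      using pE by metis
  qed
  with iV have "inv' p \<in> carrier (aut_group V E)"
    by (simp add: aut_group_def)
  moreover have "inv' p \<otimes>\<^bsub>aut_group V E\<^esub> p = \<one>\<^bsub>aut_group V E\<^esub>"
    using pV by (simp add: aut_group_def permutes_inv_o)
  ultimately show "\<exists>q\<in>carrier (aut_group V E). q \<otimes>\<^bsub>aut_group V E\<^esub> p = \<one>\<^bsub>aut_group V E\<^esub>"
    by blast
next
  fix p q assume "p \<in> carrier (aut_group V E)" "q \<in> carrier (aut_group V E)"
  then have pV: "p permutes V" and pE: "\<And>A. A \<subseteq> V \<Longrightarrow> p ` A \<in> E \<longleftrightarrow> A \<in> E"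
    and qV: "q permutes V" and qE: "\<And>A. A \<subseteq> V \<Longrightarrow> q ` A \<in> E \<longleftrightarrow> A \<in> E"
    by (auto simp: aut_group_def)
  have "(p \<circ> q) ` A \<in> E \<longleftrightarrow> A \<in> E" if "A \<subseteq> V" for A
  proof -
    have "q ` A \<subseteq> V"
      using qV that permutes_image by blast
    then show ?thesis
      using pE qE that by (metis image_comp)
  qed
  then show "p \<otimes>\<^bsub>aut_group V E\<^esub> q \<in> carrier (aut_group V E)"
    using pV qV by (simp add: aut_group_def permutes_compose)
qed (auto simp: aut_group_def permutes_id comp_assoc)

lemma M11_is_group: "group M11"
proof -
  interpret group "sym_group 11"
    by (rule sym_group_is_group)
  have "cycle_of_list [1, 2, 3, 4, 5, 6, 7, 8, 9, 10, 11::nat] permutes {1..11}"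
    by (rule permutes_subset [OF cycle_permutes]) auto
  moreover have "cycle_of_list [3, 7, 11, 8::nat] permutes {1..11}"
    by (rule permutes_subset [OF cycle_permutes]) auto
  moreover have "cycle_of_list [4, 10, 5, 6::nat] permutes {1..11}"
    by (rule permutes_subset [OF cycle_permutes]) auto
  ultimately have "{cycle_of_list [1, 2, 3, 4, 5, 6, 7, 8, 9, 10, 11],
      cycle_of_list [3, 7, 11, 8] \<circ> cycle_of_list [4, 10, 5, 6]} \<subseteq> carrier (sym_group 11)"
    by (simp only: insert_subset empty_subsetI sym_group_carrier permutes_compose simp_thms)
  then show ?thesis
    unfolding M11_def using generate_is_subgroup subgroup_imp_group by blast
qed

end

theory Submission
  imports Defs
begin

text \<open>
  The Hadamard 3-(12,6,2) design on \<open>{1..12}\<close> has 22 blocks of size 6 that come in 11 complementary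
  pairs, so it amounts to 11 balanced two-colourings of the points. Its automorphism group is
  \<open>M\<^sub>1\<^sub>1\<close>, acting 3-transitively on the 12 points and in its natural way on the 11 colourings.
  The hyperedges of the wanted design are the 4-sets that are monochromatic in no colouring, and
  thus they are invariant under the group. Counting is reduced by 3-transitivity to the hyperedges
  through one triple. Points separate colourings and colourings determine the action on the points,
  so the relation ``\<open>h\<close> acts on points as \<open>g\<close> acts on colourings'' is the graph of an
  isomorphism between two permutation groups.
\<close>

section \<open>The eleven colourings\<close>

text \<open>
  The point 12 plays the role of infinity, 11 that of the residue 0, and the residue class
  \<open>{1, 3, 4, 5, 9}\<close> consists of the nonzero squares modulo 11. For the non-squares the second
  generator of \<open>M11\<close> would not act on the colourings.
\<close>

definition white :: "nat \<Rightarrow> nat \<Rightarrow> bool"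
  where "white i x \<longleftrightarrow> x = 12 \<or> (x + 11 - i) mod 11 \<in> {1, 3, 4, 5, 9}"

text \<open>A symmetry may exchange the two colours of a colouring, as \<open>quart\<close> does for
  index 1, so only the partition into two halves is compared.\<close>

definition same_side :: "nat \<Rightarrow> nat \<Rightarrow> nat \<Rightarrow> bool"
  where "same_side i x y \<longleftrightarrow> (white i x \<longleftrightarrow> white i y)"

definition compatible :: "(nat \<Rightarrow> nat) \<Rightarrow> (nat \<Rightarrow> nat) \<Rightarrow> bool"
  where "compatible h g \<longleftrightarrow> h permutes {1..12} \<and> g permutes {1..11} \<and>
    (\<forall>i\<in>{1..11}. \<forall>x\<in>{1..12}. \<forall>y\<in>{1..12}. same_side (g i) (h x) (h y) \<longleftrightarrow> same_side i x y)"

lemma white_12: "white i 12"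
  by (simp add: white_def)

lemma atLeastAtMost_1_11: "{1..11} = {1, 2, 3, 4, 5, 6, 7, 8, 9, 10, 11::nat}"
  by code_simp

lemma atLeastAtMost_1_12: "{1..12} = {1, 2, 3, 4, 5, 6, 7, 8, 9, 10, 11, 12::nat}"
  by code_simp

lemma transpose_apply: "transpose a b c = (if c = a then b else if c = b then a else c)"
  by (simp add: transpose_def)

text \<open>
  In the evaluations below the quantifiers are unrolled before the definitions are unfolded:
  simplifying under the binder would split on every transposition of a symbolic argument.
\<close>

lemma compatibleI:
  assumes "h permutes {1..12}" "g permutes {1..11}"
    and "\<forall>i\<in>{1..11}. \<forall>x\<in>{1..12}. same_side (g i) (h x) (h 12) \<longleftrightarrow> white i x"
  shows "compatible h g"
proof -
  \<comment> \<open>Comparison with the one point 12 suffices: two points are on the same side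
    exactly if both or neither are on the side of the reference point.\<close>
  have "same_side (g i) (h x) (h y) \<longleftrightarrow> same_side i x y"
    if "i \<in> {1..11}" "x \<in> {1..12}" "y \<in> {1..12}" for i x y
    using assms(3)[rule_format, of i x] assms(3)[rule_format, of i y] that
    by (auto simp: same_side_def)
  then show ?thesis
    using assms(1,2) by (simp add: compatible_def)
qed

section \<open>Four symmetries of the system of colourings\<close>

abbreviation rot :: "nat \<Rightarrow> nat"
  where "rot \<equiv> cycle_of_list [1, 2, 3, 4, 5, 6, 7, 8, 9, 10, 11]"

lemma cycle_of_list_permutes: "set xs \<subseteq> S \<Longrightarrow> cycle_of_list xs permutes S"
  by (rule permutes_subset [OF cycle_permutes])

text \<open>Apart from the fixed point 12, colours depend only on the residue x - i, which adding 1
  to points and indices alike leaves unchanged.\<close>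

lemma compatible_rot: "compatible rot rot"
proof (rule compatibleI)
  show "\<forall>i\<in>{1..11}. \<forall>x\<in>{1..12}. same_side (rot i) (rot x) (rot 12) \<longleftrightarrow> white i x"
    unfolding atLeastAtMost_1_11 atLeastAtMost_1_12 ball_simps bex_simps simp_thms
    by (simp add: same_side_def white_def transpose_apply)
qed (rule cycle_of_list_permutes; simp)+

abbreviation mul3 :: "nat \<Rightarrow> nat"
  where "mul3 \<equiv> cycle_of_list [1, 3, 9, 5, 4] \<circ> cycle_of_list [2, 6, 7, 10, 8]"

text \<open>This is multiplication by 3 modulo 11. As 3 is a square, x - i is a nonzero square
  before exactly if it is one after.\<close>

lemma compatible_mul3: "compatible mul3 mul3"
proof (rule compatibleI)
  show "\<forall>i\<in>{1..11}. \<forall>x\<in>{1..12}. same_side (mul3 i) (mul3 x) (mul3 12) \<longleftrightarrow> white i x"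
    unfolding atLeastAtMost_1_11 atLeastAtMost_1_12 ball_simps bex_simps simp_thms
    by (simp add: same_side_def white_def transpose_apply)
qed (intro permutes_compose cycle_of_list_permutes; simp)+

abbreviation invol :: "nat \<Rightarrow> nat"
  where "invol \<equiv> cycle_of_list [1, 7] \<circ> cycle_of_list [2, 3] \<circ> cycle_of_list [4, 8] \<circ> cycle_of_list [5, 9]"

abbreviation invol' :: "nat \<Rightarrow> nat"
  where "invol' \<equiv> cycle_of_list [1, 5] \<circ> cycle_of_list [2, 8] \<circ> cycle_of_list [4, 11] \<circ> cycle_of_list [6, 7]"

text \<open>This symmetry fixes 11 and 12 and takes the non-square 7 to the square 1, which
  \<open>mul3\<close> cannot do. Its actions on points and on indices differ.\<close>

lemma compatible_invol: "compatible invol invol'"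
proof (rule compatibleI)
  show "\<forall>i\<in>{1..11}. \<forall>x\<in>{1..12}. same_side (invol' i) (invol x) (invol 12) \<longleftrightarrow> white i x"
    unfolding atLeastAtMost_1_11 atLeastAtMost_1_12 ball_simps bex_simps simp_thms
    by (simp add: same_side_def white_def transpose_apply)
qed (intro permutes_compose cycle_of_list_permutes; simp)+

text \<open>The lift to the 12 points of the generator \<open>(3 7 11 8)(4 10 5 6)\<close>.\<close>

abbreviation quart :: "nat \<Rightarrow> nat"
  where "quart \<equiv> cycle_of_list [1, 12] \<circ> cycle_of_list [2, 7, 10, 3] \<circ> cycle_of_list [4, 11] \<circ> cycle_of_list [5, 9, 6, 8]"

abbreviation quart' :: "nat \<Rightarrow> nat"
  where "quart' \<equiv> cycle_of_list [3, 7, 11, 8] \<circ> cycle_of_list [4, 10, 5, 6]"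

lemma compatible_quart: "compatible quart quart'"
proof (rule compatibleI)
  show "\<forall>i\<in>{1..11}. \<forall>x\<in>{1..12}. same_side (quart' i) (quart x) (quart 12) \<longleftrightarrow> white i x"
    unfolding atLeastAtMost_1_11 atLeastAtMost_1_12 ball_simps bex_simps simp_thms
    by (simp add: same_side_def white_def transpose_apply)
qed (intro permutes_compose cycle_of_list_permutes; simp)+

lemma index_determined:
  "\<forall>i\<in>{1..11}. \<forall>j\<in>{1..11}. (\<forall>x\<in>{1..12}. white i x \<longleftrightarrow> white j x) \<longrightarrow> i = j"
  unfolding atLeastAtMost_1_11 atLeastAtMost_1_12 ball_simps bex_simps simp_thms
  by (simp add: white_def)

text \<open>
  A point permutation that fixes all colourings and maps 12 to \<open>j\<close> multiplies the \<open>\<plusminus>1\<close>-vector of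
  colours of each point by that of \<open>j\<close>. The product for the point \<open>rot j\<close> is the vector of no point.
\<close>

lemma no_translation:
  "\<forall>j\<in>{1..11}. \<forall>y\<in>{1..12}. \<exists>i\<in>{1..11}. white i y \<noteq> (white i (rot j) \<longleftrightarrow> white i j)"
  unfolding atLeastAtMost_1_11 atLeastAtMost_1_12 ball_simps bex_simps simp_thms
  by (simp add: white_def transpose_apply)

lemma points_separated:
  "\<forall>x\<in>{1..12}. \<forall>y\<in>{1..12}. (\<forall>i\<in>{1..11}. white i x \<longleftrightarrow> white i y) \<longrightarrow> x = y"
  unfolding atLeastAtMost_1_11 atLeastAtMost_1_12 ball_simps bex_simps simp_thms
  by (simp add: white_def)

section \<open>The action on points and colourings\<close>

lemma compatible_comp:
  assumes "compatible h g" "compatible h' g'"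
  shows "compatible (h \<circ> h') (g \<circ> g')"
proof -
  have "g' i \<in> {1..11}" if "i \<in> {1..11}" for i
    using assms(2) that permutes_in_image unfolding compatible_def by metis
  moreover have "h' x \<in> {1..12}" if "x \<in> {1..12}" for x
    using assms(2) that permutes_in_image unfolding compatible_def by metis
  ultimately show ?thesis
    using assms by (simp add: compatible_def permutes_compose del: atLeastAtMost_iff)
qed

lemma compatible_id: "compatible id id"
  by (simp add: compatible_def permutes_id)

lemma compatible_inv:
  assumes "compatible h g"
  shows "compatible (inv' h) (inv' g)"
proof -
  have h: "h permutes {1..12}" and g: "g permutes {1..11}"
    using assms by (auto simp: compatible_def)
  have "inv' g i \<in> {1..11}" if "i \<in> {1..11}" for i
    using that permutes_in_image [OF permutes_inv [OF g]] by blast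
  moreover have "inv' h x \<in> {1..12}" if "x \<in> {1..12}" for x
    using that permutes_in_image [OF permutes_inv [OF h]] by blast
  ultimately have "same_side i x y \<longleftrightarrow> same_side (inv' g i) (inv' h x) (inv' h y)"
    if "i \<in> {1..11}" "x \<in> {1..12}" "y \<in> {1..12}" for i x y
    using assms that permutes_inverses(1) [OF g] permutes_inverses(1) [OF h]
    unfolding compatible_def by metis
  then show ?thesis
    using h g by (simp add: compatible_def permutes_inv)
qed

lemma compatible_funpow: "compatible h g \<Longrightarrow> compatible (h ^^ n) (g ^^ n)"
  by (induction n) (simp_all add: compatible_comp compatible_id)

section \<open>Faithfulness of the actions on points and on colourings\<close>

lemma compatible_id_left:
  assumes "compatible id g"
  shows "g = id"
proof -
  have g: "g permutes {1..11}"
    using assms by (simp add: compatible_def)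
  have "g i = i" if i: "i \<in> {1..11}" for i
  proof -
    have gi: "g i \<in> {1..11}"
      using i permutes_in_image [OF g] by blast
    \<comment> \<open>As 12 is always white, comparison with it turns sides into colours.\<close>
    have "same_side (g i) x 12 \<longleftrightarrow> same_side i x 12" if "x \<in> {1..12}" for x
      using assms i that by (simp add: compatible_def)
    then have "\<forall>x\<in>{1..12}. white (g i) x \<longleftrightarrow> white i x"
      by (simp add: same_side_def white_12)
    then show ?thesis
      using index_determined gi i by blast
  qed
  then show ?thesis
    using g by (metis eq_id_iff permutes_not_in)
qed

text \<open>Such an \<open>h\<close> exchanges the colours of exactly those colourings in which
  \<open>h 12\<close> is not white. By \<open>no_translation\<close> it must fix 12; then all
  colours are kept, and separation of points applies.\<close>

lemma compatible_id_right:
  assumes "compatible h id"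
  shows "h = id"
proof -
  have h: "h permutes {1..12}"
    using assms by (simp add: compatible_def)
  have h_in: "h x \<in> {1..12}" if "x \<in> {1..12}" for x
    using that permutes_in_image [OF h] by blast
  have "same_side i (h x) (h 12) \<longleftrightarrow> same_side i x 12" if "i \<in> {1..11}" "x \<in> {1..12}" for i x
    using assms that by (simp add: compatible_def)
  then have white_h: "white i (h x) \<longleftrightarrow> (white i x \<longleftrightarrow> white i (h 12))"
    if "i \<in> {1..11}" "x \<in> {1..12}" for i x
    using that by (auto simp: same_side_def white_12)
  have "h 12 = 12"
  proof (rule ccontr)
    assume "h 12 \<noteq> 12"
    then have j: "h 12 \<in> {1..11}"
      using h_in [of 12] by auto
    moreover have "rot permutes {1..11}"
      using compatible_rot by (simp add: compatible_def)
    ultimately have "rot (h 12) \<in> {1..11}"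
      by (simp only: permutes_in_image)
    then have x: "rot (h 12) \<in> {1..12}"
      by auto
    show False
      using no_translation [rule_format, OF j h_in [OF x]] white_h [OF _ x] by blast
  qed
  then have "h x = x" if "x \<in> {1..12}" for x
    using points_separated [rule_format, OF h_in [OF that] that] white_h [OF _ that]
    by (simp add: white_12)
  then show ?thesis
    using h by (metis eq_id_iff permutes_not_in)
qed

text \<open>The quotient of the two pairs is trivial on points, hence on colourings. This will make
  the lifting of \<open>M11\<close> to points injective.\<close>

lemma compatible_right_unique:
  assumes "compatible h g" "compatible h g'"
  shows "g = g'"
proof -
  have g: "g permutes {1..11}" and h: "h permutes {1..12}"
    using assms by (auto simp: compatible_def)
  have "compatible id (inv' g \<circ> g')"
    using compatible_comp [OF compatible_inv [OF assms(1)] assms(2)] permutes_inv_o(2) [OF h] by simp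
  then have "inv' g \<circ> g' = id"
    by (rule compatible_id_left)
  then show ?thesis
    by (metis g comp_assoc comp_id id_comp permutes_inv_o(1))
qed

text \<open>The same quotient argument on the other side. It will make the lifting of
  \<open>M11\<close> multiplicative.\<close>

lemma compatible_left_unique:
  assumes "compatible h g" "compatible h' g"
  shows "h = h'"
proof -
  have g: "g permutes {1..11}" and h: "h permutes {1..12}"
    using assms by (auto simp: compatible_def)
  have "compatible (inv' h \<circ> h') id"
    using compatible_comp [OF compatible_inv [OF assms(1)] assms(2)] permutes_inv_o(2) [OF g] by simp
  then have "inv' h \<circ> h' = id"
    by (rule compatible_id_right)
  then show ?thesis
    by (metis h comp_assoc comp_id id_comp permutes_inv_o(1))
qed

section \<open>Hyperedges and 3-transitivity\<close>

definition blocks :: "nat set set"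
  where "blocks = {A. A \<subseteq> {1..12} \<and> card A = 4 \<and> (\<forall>i\<in>{1..11}. \<exists>x\<in>A. \<exists>y\<in>A. \<not> same_side i x y)}"

lemma compatible_image_blocks_iff:
  assumes "compatible h g" "A \<subseteq> {1..12}"
  shows "h ` A \<in> blocks \<longleftrightarrow> A \<in> blocks"
proof -
  have h: "h permutes {1..12}" and g: "g permutes {1..11}"
    using assms by (auto simp: compatible_def)
  have "h ` A \<subseteq> {1..12}"
    using assms(2) permutes_image [OF h] by blast
  moreover have "card (h ` A) = card A"
    by (intro card_image permutes_inj_on [OF h])
  \<comment> \<open>\<open>g\<close> permutes the indices, so the colourings can be run through as
    \<open>g i\<close>, where compatibility applies.\<close>
  moreover have "(\<forall>i\<in>{1..11}. \<exists>x\<in>h ` A. \<exists>y\<in>h ` A. \<not> same_side i x y) \<longleftrightarrow>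
    (\<forall>i\<in>g ` {1..11}. \<exists>x\<in>h ` A. \<exists>y\<in>h ` A. \<not> same_side i x y)"
    by (simp only: permutes_image [OF g])
  moreover have "same_side (g i) (h x) (h y) \<longleftrightarrow> same_side i x y"
    if "i \<in> {1..11}" "x \<in> A" "y \<in> A" for i x y
    using that assms unfolding compatible_def by blast
  ultimately show ?thesis
    using assms(2) by (simp add: blocks_def del: atLeastAtMost_iff)
qed

lemma compatible_in_aut_group: "compatible h g \<Longrightarrow> h \<in> carrier (aut_group {1..12} blocks)"
  using compatible_image_blocks_iff by (auto simp: aut_group_def compatible_def)

section \<open>Moving points successively to 12, 11 and 1\<close>

lemma funpow_rot: "x \<in> {1..11} \<Longrightarrow> (rot ^^ (11 - x)) x = 11 \<and> (rot ^^ (11 - x)) 12 = 12"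
  unfolding atLeastAtMost_1_11
  by (elim insertE emptyE) (simp_all add: eval_nat_numeral transpose_apply)

lemma compatible_to_12:
  assumes "x \<in> {1..12}"
  shows "\<exists>h g. compatible h g \<and> h x = 12"
proof (cases "x = 12")
  case True
  then show ?thesis
    using compatible_id by force
next
  case False
  then have x: "x \<in> {1..11}"
    using assms by auto
  \<comment> \<open>Of the four symmetries only \<open>quart\<close> moves 12; it exchanges 12 with
    1, and \<open>rot\<close> takes 11 to 1.\<close>
  have "quart (rot 11) = 12"
    by (simp add: transpose_apply)
  then have "(quart \<circ> rot \<circ> (rot ^^ (11 - x))) x = 12"
    using funpow_rot [OF x] by (simp only: comp_apply)
  moreover have "compatible (quart \<circ> rot \<circ> (rot ^^ (11 - x))) (quart' \<circ> rot \<circ> (rot ^^ (11 - x)))"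
    by (intro compatible_comp compatible_quart compatible_rot compatible_funpow)
  ultimately show ?thesis
    by blast
qed

lemma compatible_to_11:
  assumes "x \<in> {1..11}"
  shows "\<exists>h g. compatible h g \<and> h 12 = 12 \<and> h x = 11"
  using funpow_rot [OF assms] compatible_funpow [OF compatible_rot] by blast

text \<open>The orbits of multiplication by 3 on the nonzero residues are the squares and the
  non-squares, represented by 1 and 7.\<close>

lemma funpow_mul3:
  assumes "x \<in> {1..10}"
  shows "\<exists>n. (mul3 ^^ n) x = 1 \<or> (mul3 ^^ n) x = 7"
proof -
  have "{1..10} = {1, 2, 3, 4, 5, 6, 7, 8, 9, 10::nat}"
    by code_simp
  moreover have "\<forall>x\<in>{1, 2, 3, 4, 5, 6, 7, 8, 9, 10}. \<exists>n\<in>{0, 1, 2, 3, 4}. (mul3 ^^ n) x = 1 \<or> (mul3 ^^ n) x = 7"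
    unfolding ball_simps bex_simps simp_thms
    by (simp add: numeral_eq_Suc transpose_apply)
  ultimately show ?thesis
    using assms by (metis (no_types, lifting))
qed

lemma compatible_to_1:
  assumes "x \<in> {1..10}"
  shows "\<exists>h g. compatible h g \<and> h 12 = 12 \<and> h 11 = 11 \<and> h x = 1"
proof -
  obtain n where n: "(mul3 ^^ n) x = 1 \<or> (mul3 ^^ n) x = 7"
    using funpow_mul3 [OF assms] by blast
  have fixed: "(mul3 ^^ n) 12 = 12" "(mul3 ^^ n) 11 = 11"
    by (induction n) (simp_all add: transpose_apply)
  have m: "compatible (mul3 ^^ n) (mul3 ^^ n)"
    by (rule compatible_funpow [OF compatible_mul3])
  \<comment> \<open>\<open>invol\<close> joins the two orbits of \<open>mul3\<close> without moving
    12 or 11.\<close>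
  have "invol 12 = 12" "invol 11 = 11" "invol 7 = 1"
    by (simp_all add: transpose_apply)
  then have "(invol \<circ> mul3 ^^ n) 12 = 12" "(invol \<circ> mul3 ^^ n) 11 = 11"
    "(mul3 ^^ n) x = 7 \<Longrightarrow> (invol \<circ> mul3 ^^ n) x = 1"
    using fixed by (simp_all only: comp_apply)
  then show ?thesis
    using n m fixed compatible_comp [OF compatible_invol m] by blast
qed

text \<open>Three moves are composed, each fixing the points already placed: the second lies in the
  stabiliser of 12, the third in that of 12 and 11.\<close>

lemma compatible_to_triple:
  assumes "distinct [x, y, z]" "{x, y, z} \<subseteq> {1..12}"
  shows "\<exists>h g. compatible h g \<and> h x = 12 \<and> h y = 11 \<and> h z = 1"
proof -
  obtain h g where hg: "compatible h g" "h x = 12"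
    using compatible_to_12 assms by blast
  have h: "h permutes {1..12}"
    using hg by (simp add: compatible_def)
  have "h y \<noteq> h x" "h y \<in> {1..12}"
    using assms permutes_in_image [OF h] by (auto simp: inj_eq permutes_inj [OF h])
  then have "h y \<in> {1..11}"
    using hg(2) by auto
  then obtain h' g' where hg': "compatible h' g'" "h' 12 = 12" "h' (h y) = 11"
    using compatible_to_11 by blast
  define k where "k = h' \<circ> h"
  have k: "compatible k (g' \<circ> g)" "k x = 12" "k y = 11"
    using hg hg' compatible_comp by (auto simp: k_def)
  then have kp: "k permutes {1..12}"
    by (simp add: compatible_def)
  have "k z \<noteq> k x" "k z \<noteq> k y" "k z \<in> {1..12}"
    using assms permutes_in_image [OF kp] by (auto simp: inj_eq permutes_inj [OF kp])
  then have "k z \<in> {1..10}"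
    using k by auto
  then obtain h'' g'' where "compatible h'' g''" "h'' 12 = 12" "h'' 11 = 11" "h'' (k z) = 1"
    using compatible_to_1 by blast
  then show ?thesis
    using k compatible_comp [of h'' g'' k "g' \<circ> g"] by (intro exI [of _ "h'' \<circ> k"] exI [of _ "g'' \<circ> (g' \<circ> g)"]) simp
qed

lemma three_transitive_blocks: "three_transitive {1..12} blocks"
  unfolding three_transitive_def
proof (intro ballI impI)
  fix x y z x' y' z' :: nat
  assume V: "x \<in> {1..12}" "y \<in> {1..12}" "z \<in> {1..12}" "x' \<in> {1..12}" "y' \<in> {1..12}" "z' \<in> {1..12}"
    and d: "distinct [x, y, z]" "distinct [x', y', z']"
  obtain h g where hg: "compatible h g" "h x = 12" "h y = 11" "h z = 1"
    using compatible_to_triple [OF d(1)] V by blast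
  obtain h' g' where hg': "compatible h' g'" "h' x' = 12" "h' y' = 11" "h' z' = 1"
    using compatible_to_triple [OF d(2)] V by blast
  have "h' permutes {1..12}"
    using hg' by (simp add: compatible_def)
  then have "(inv' h' \<circ> h) x = x'" "(inv' h' \<circ> h) y = y'" "(inv' h' \<circ> h) z = z'"
    using hg hg' by (metis comp_apply permutes_inverses(2))+
  moreover have "inv' h' \<circ> h \<in> carrier (aut_group {1..12} blocks)"
    using compatible_in_aut_group compatible_comp compatible_inv hg hg' by blast
  ultimately show "\<exists>p\<in>carrier (aut_group {1..12} blocks). p x = x' \<and> p y = y' \<and> p z = z'"
    by blast
qed

section \<open>Counting hyperedges\<close>

text \<open>A form of membership in \<open>blocks\<close> that can be evaluated for explicit points.
  Being on the same side is an equivalence relation, so comparing with \<open>a\<close> is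
  enough.\<close>

definition mixed :: "nat \<Rightarrow> nat \<Rightarrow> nat \<Rightarrow> nat \<Rightarrow> bool"
  where "mixed a b c d \<longleftrightarrow> (\<forall>i\<in>{1..11}. \<not> (same_side i a b \<and> same_side i a c \<and> same_side i a d))"

lemma quadruple_in_blocks_iff:
  assumes "distinct [a, b, c, d]" "{a, b, c, d} \<subseteq> {1..12}"
  shows "{a, b, c, d} \<in> blocks \<longleftrightarrow> mixed a b c d"
proof -
  have "(\<exists>x\<in>{a, b, c, d}. \<exists>y\<in>{a, b, c, d}. \<not> same_side i x y) \<longleftrightarrow>
    \<not> (same_side i a b \<and> same_side i a c \<and> same_side i a d)" for i
    by (auto simp: same_side_def)
  moreover have "card {a, b, c, d} = 4"
    using assms(1) by simp
  ultimately show ?thesis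
    using assms(2) by (simp only: blocks_def mixed_def mem_Collect_eq simp_thms)
qed

lemma atLeastAtMost_2_10: "{2..10} = {2, 3, 4, 5, 6, 7, 8, 9, 10::nat}"
  by code_simp

text \<open>Evaluation at the base triple gives three possible fourth points, hence \<lambda> =
  3.\<close>

lemma mixed_12_11_1: "\<forall>w\<in>{2..10}. mixed 12 11 1 w \<longleftrightarrow> w \<in> {3, 4, 7}"
  unfolding atLeastAtMost_1_11 atLeastAtMost_2_10 mixed_def ball_simps simp_thms
  by (simp add: same_side_def white_def)

text \<open>The summands run over the five 4-subsets of \<open>{12, 11, 1, u, v}\<close>. By
  3-transitivity this case yields the claim for all 5-sets.\<close>

lemma mixed_count_12_11_1:
  "\<forall>u\<in>{2..10}. \<forall>v\<in>{2..10}. u \<noteq> v \<longrightarrow>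
    of_bool (mixed 12 11 1 u) + of_bool (mixed 12 11 1 v) + of_bool (mixed 12 11 u v) +
    of_bool (mixed 12 1 u v) + of_bool (mixed 11 1 u v) \<in> {0, 2::nat}"
  unfolding atLeastAtMost_1_11 atLeastAtMost_2_10 mixed_def ball_simps simp_thms
  by (simp add: same_side_def white_def)

lemma finite_blocks: "finite blocks"
  by (rule finite_subset [of _ "Pow {1..12}"]) (auto simp: blocks_def)

lemma triple_to_12_11_1:
  assumes "T \<subseteq> {1..12}" "card T = 3"
  shows "\<exists>h g. compatible h g \<and> h ` T = {12, 11, 1}"
proof -
  obtain x y z where T: "T = {x, y, z}" "distinct [x, y, z]"
    using assms(2) by (auto simp: card_3_iff)
  have "{x, y, z} \<subseteq> {1..12}"
    using assms(1) T(1) by simp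
  from compatible_to_triple [OF T(2) this]
  obtain h g where "compatible h g" "h x = 12" "h y = 11" "h z = 1"
    by blast
  then have "compatible h g \<and> h ` T = {12, 11, 1}"
    by (simp add: T(1))
  then show ?thesis
    by blast
qed

lemma blocks_through_12_11_1:
  "{A \<in> blocks. {12, 11, 1} \<subseteq> A} = {{12, 11, 1, 3}, {12, 11, 1, 4}, {12, 11, 1, 7}}"
proof -
  have in_blocks: "{12, 11, 1, w} \<in> blocks \<longleftrightarrow> w \<in> {3, 4, 7}" if "w \<in> {2..10}" for w
    using mixed_12_11_1 quadruple_in_blocks_iff [of 12 11 1 w] that by auto
  have "\<exists>w\<in>{2..10}. A = {12, 11, 1, w}" if "A \<in> blocks" "{12, 11, 1} \<subseteq> A" for A
  proof -
    have A: "A \<subseteq> {1..12}" "card A = 4"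
      using that(1) by (auto simp: blocks_def)
    then have "finite A"
      using finite_subset by blast
    then have "card (A - {12, 11, 1}) = 1"
      using A that(2) by (simp add: card_Diff_subset)
    then obtain w where w: "A - {12, 11, 1} = {w}"
      by (auto simp: card_1_singleton_iff)
    then have "w \<in> A - {12, 11, 1}"
      by simp
    then have "w \<in> {1..12}" "w \<notin> {12, 11, 1}"
      using A(1) by blast+
    then have "w \<in> {2..10}"
      by auto
    then show ?thesis
      using w that(2) by blast
  qed
  then have "{A \<in> blocks. {12, 11, 1} \<subseteq> A} = (\<lambda>w. {12, 11, 1, w}) ` {w \<in> {2..10}. {12, 11, 1, w} \<in> blocks}"
    by blast
  also have "{w \<in> {2..10}. {12, 11, 1, w} \<in> blocks} = {3, 4, 7}"
    using in_blocks by auto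
  finally show ?thesis
    by simp
qed

text \<open>A compatible permutation taking \<open>T\<close> to \<open>{12, 11, 1}\<close> maps the
  hyperedges through \<open>T\<close> bijectively to those through the base triple.\<close>

lemma card_blocks_through_triple:
  assumes "T \<subseteq> {1..12}" "card T = 3"
  shows "card {A \<in> blocks. T \<subseteq> A} = 3"
proof -
  obtain h g where hg: "compatible h g" "h ` T = {12, 11, 1}"
    using triple_to_12_11_1 [OF assms] by blast
  have h: "h permutes {1..12}"
    using hg(1) by (simp add: compatible_def)
  have "bij_betw (image h) {A \<in> blocks. T \<subseteq> A} {A \<in> blocks. h ` T \<subseteq> A}"
    unfolding bij_betw_def
  proof
    show "inj_on (image h) {A \<in> blocks. T \<subseteq> A}"
      by (rule inj_onI) (simp add: inj_image_eq_iff permutes_inj [OF h])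
    have "A \<in> image h ` {A \<in> blocks. T \<subseteq> A}" if "A \<in> blocks" "h ` T \<subseteq> A" for A
    proof (rule image_eqI)
      show "A = h ` inv' h ` A"
        using permutes_inv_o(1) [OF h] by (simp add: image_comp)
      have "inv' h ` h ` T = T"
        using permutes_inv_o(2) [OF h] by (simp add: image_comp)
      moreover have "A \<subseteq> {1..12}"
        using that(1) by (simp add: blocks_def)
      ultimately show "inv' h ` A \<in> {A \<in> blocks. T \<subseteq> A}"
        using that compatible_image_blocks_iff [OF compatible_inv [OF hg(1)]]
        by (metis (no_types, lifting) image_mono mem_Collect_eq)
    qed
    moreover have "h ` A \<in> blocks" if "A \<in> blocks" for A
    proof -
      have "A \<subseteq> {1..12}"
        using that by (simp add: blocks_def)
      then show ?thesis
        using that compatible_image_blocks_iff [OF hg(1)] by blast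
    qed
    ultimately show "image h ` {A \<in> blocks. T \<subseteq> A} = {A \<in> blocks. h ` T \<subseteq> A}"
      by (auto intro: image_mono)
  qed
  then have "card {A \<in> blocks. T \<subseteq> A} = card {A \<in> blocks. {12, 11, 1} \<subseteq> A}"
    using hg(2) by (simp add: bij_betw_same_card)
  also have "\<dots> = 3"
  proof -
    have "{12, 11, 1, 3} \<noteq> {12, 11, 1, 4::nat}" "{12, 11, 1, 3} \<noteq> {12, 11, 1, 7::nat}"
      "{12, 11, 1, 4} \<noteq> {12, 11, 1, 7::nat}"
      by code_simp+
    then show ?thesis
      unfolding blocks_through_12_11_1 by simp
  qed
  finally show ?thesis .
qed

lemma is_design_blocks: "is_design 3 12 4 3 {1..12} blocks"
  using card_blocks_through_triple
  by (simp add: is_design_def uniform_hypergraph_def) (auto simp: blocks_def)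

text \<open>Double counting of pairs of a triple inside a hyperedge: a hyperedge contains 4 triples
  and each of the 220 triples lies in 3 hyperedges.\<close>

lemma card_blocks: "card blocks = 165"
proof -
  define Ts where "Ts = {T. T \<subseteq> {1..12::nat} \<and> card T = 3}"
  have fin: "finite Ts"
    by (rule finite_subset [of _ "Pow {1..12}"]) (auto simp: Ts_def)
  have "card {T \<in> Ts. T \<subseteq> A} = 4" if "A \<in> blocks" for A
  proof -
    have A: "A \<subseteq> {1..12}" "card A = 4"
      using that by (auto simp: blocks_def)
    then have "finite A"
      using finite_subset by blast
    moreover have "{T \<in> Ts. T \<subseteq> A} = {T. T \<subseteq> A \<and> card T = 3}"
      using A(1) by (auto simp: Ts_def)
    ultimately show ?thesis
      using n_subsets [of A 3] A(2) by (simp add: numeral_eq_Suc)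
  qed
  then have "(\<Sum>T\<in>Ts. card {A \<in> blocks. T \<subseteq> A}) = 4 * card blocks"
    by (intro sum_multicount fin finite_blocks) blast
  moreover have "(\<Sum>T\<in>Ts. card {A \<in> blocks. T \<subseteq> A}) = 3 * card Ts"
    using card_blocks_through_triple by (simp add: Ts_def)
  moreover have "card Ts = 12 choose 3"
    using n_subsets [of "{1..12::nat}" 3] by (simp add: Ts_def)
  moreover have "12 choose 3 = (220::nat)"
    by (simp add: numeral_eq_Suc)
  ultimately show ?thesis
    by simp
qed

section \<open>Hyperedges spanned by five points\<close>

lemma card_filter_set:
  assumes "distinct xs"
  shows "card {x \<in> set xs. P x} = (\<Sum>x\<leftarrow>xs. of_bool (P x))"
  using assms
proof (induction xs)
  case (Cons a xs)
  then have "{x \<in> set (a # xs). P x} = (if P a then insert a {x \<in> set xs. P x} else {x \<in> set xs. P x})"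
    by auto
  then show ?case
    using Cons by simp
qed simp

lemma card_spanned_quintuple:
  assumes d: "distinct [a, b, c, d, e]" and V: "{a, b, c, d, e} \<subseteq> {1..12}"
  shows "card (spanned blocks {a, b, c, d, e}) =
    of_bool (mixed a b c d) + of_bool (mixed a b c e) + of_bool (mixed a b d e) +
    of_bool (mixed a c d e) + of_bool (mixed b c d e)"
proof -
  define Q where "Q = [{a, b, c, d}, {a, b, c, e}, {a, b, d, e}, {a, c, d, e}, {b, c, d, e}]"
  have "set Q = {A. A \<subseteq> {a, b, c, d, e} \<and> card A = 4}"
  proof
    show "set Q \<subseteq> {A. A \<subseteq> {a, b, c, d, e} \<and> card A = 4}"
      using d by (simp add: Q_def)
    show "{A. A \<subseteq> {a, b, c, d, e} \<and> card A = 4} \<subseteq> set Q"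
    proof (rule subsetI)
      fix A assume "A \<in> {A. A \<subseteq> {a, b, c, d, e} \<and> card A = 4}"
      then have A: "A \<subseteq> {a, b, c, d, e}" "card A = 4"
        by blast+
      have "card {a, b, c, d, e} = 5" "finite A"
        using d A(1) by (auto intro: finite_subset)
      \<comment> \<open>A 4-subset is determined by the one point that it omits, which leaves five
        cases.\<close>
      then have "card ({a, b, c, d, e} - A) = 1"
        using A by (simp only: card_Diff_subset)
      then obtain w where w: "{a, b, c, d, e} - A = {w}"
        by (rule card_1_singletonE)
      then have "A = {a, b, c, d, e} - {w}" "w \<in> {a, b, c, d, e}"
        using A(1) by blast+
      then show "A \<in> set Q"
        using d by (elim insertE emptyE) (auto simp: Q_def insert_Diff_if)
    qed
  qed
  then have "spanned blocks {a, b, c, d, e} = {A \<in> set Q. A \<in> blocks}"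
    by (auto simp: spanned_def blocks_def)
  moreover have "distinct Q"
    using d by (auto simp: Q_def set_eq_subset)
  ultimately have "card (spanned blocks {a, b, c, d, e}) = (\<Sum>A\<leftarrow>Q. of_bool (A \<in> blocks))"
    by (simp only: card_filter_set)
  then show ?thesis
    using d V by (simp add: Q_def quadruple_in_blocks_iff add.assoc del: atLeastAtMost_iff)
qed

lemma card_spanned_image:
  assumes "compatible h g" "X \<subseteq> {1..12}"
  shows "card (spanned blocks (h ` X)) = card (spanned blocks X)"
proof -
  have h: "h permutes {1..12}"
    using assms(1) by (simp add: compatible_def)
  have "bij_betw (image h) (Pow X) (Pow (h ` X))"
    by (intro bij_betw_Pow inj_on_imp_bij_betw permutes_inj_on [OF h])
  moreover have "h ` A \<in> blocks \<longleftrightarrow> A \<in> blocks" if "A \<in> Pow X" for A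
    using that assms(2) by (intro compatible_image_blocks_iff [OF assms(1)]) auto
  ultimately have "bij_betw (image h) {A \<in> Pow X. A \<in> blocks} {A \<in> Pow (h ` X). A \<in> blocks}"
    by (rule bij_betw_Collect)
  then show ?thesis
    by (simp add: bij_betw_same_card spanned_def conj_commute)
qed

text \<open>Any three points of \<open>X\<close> can be moved to 12, 11, 1 without changing the
  number of spanned hyperedges; the evaluation at the base triple covers the remaining two
  points.\<close>

lemma card_spanned_five:
  assumes "X \<subseteq> {1..12}" "card X = 5"
  shows "card (spanned blocks X) = 0 \<or> card (spanned blocks X) = 2"
proof -
  obtain T where T: "T \<subseteq> X" "card T = 3"
    using obtain_subset_with_card_n [of 3 X] assms(2) by auto
  have "T \<subseteq> {1..12}"
    using T(1) assms(1) by (rule subset_trans)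
  from triple_to_12_11_1 [OF this T(2)]
  obtain h g where hg: "compatible h g" "h ` T = {12, 11, 1}"
    by blast
  have h: "h permutes {1..12}"
    using hg(1) by (simp add: compatible_def)
  have hX: "h ` X \<subseteq> {1..12}" "{12, 11, 1} \<subseteq> h ` X"
    using assms(1) permutes_image [OF h] hg(2) T(1) by blast+
  have "card (h ` X) = 5"
    using assms(2) card_image [OF permutes_inj_on [OF h]] by metis
  then have "card (h ` X - {12, 11, 1}) = 2"
    using hX(2) by (simp add: card_Diff_subset)
  then obtain u v where uv: "h ` X - {12, 11, 1} = {u, v}" "u \<noteq> v"
    by (auto simp: card_2_iff)
  then have hX_eq: "h ` X = {12, 11, 1, u, v}"
    using hX(2) by blast
  have "u \<notin> {12, 11, 1}" "v \<notin> {12, 11, 1}"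
    using uv by blast+
  then have d: "distinct [12, 11, 1, u, v]"
    using uv(2) by auto
  have "u \<in> {1..12}" "v \<in> {1..12}"
    using hX(1) hX_eq by auto
  then have "u \<in> {2..10}" "v \<in> {2..10}"
    using d by auto
  then have "card (spanned blocks (h ` X)) \<in> {0, 2}"
    unfolding hX_eq card_spanned_quintuple [OF d hX(1) [unfolded hX_eq]]
    using mixed_count_12_11_1 uv(2) by blast
  then show ?thesis
    using card_spanned_image [OF hg(1) assms(1)] by auto
qed

section \<open>The embedding of the Mathieu group\<close>

text \<open>The generators lift to \<open>rot\<close> and \<open>quart\<close>, and compatible pairs
  are closed under composition and inverses.\<close>

lemma M11_compatible:
  assumes "g \<in> carrier M11"
  shows "\<exists>h. compatible h g"
proof -
  have gens: "\<exists>h. compatible h x" if "x \<in> {rot, quart'}" for x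
    using that compatible_rot compatible_quart by auto
  have "g \<in> generate (sym_group 11) {rot, quart'}"
    using assms by (simp add: M11_def)
  then show ?thesis
  proof induction
    case one
    then show ?case
      unfolding sym_group_one using compatible_id by blast
  next
    case (incl x)
    then show ?case
      by (rule gens)
  next
    case (inv x)
    then obtain h where h: "compatible h x"
      using gens by blast
    then have "inv\<^bsub>sym_group 11\<^esub> x = inv' x"
      by (intro sym_group_inv_equality) (simp add: sym_group_carrier compatible_def)
    then show ?case
      using compatible_inv [OF h] by auto
  next
    case (eng x y)
    then show ?case
      unfolding sym_group_mult using compatible_comp by blast
  qed
qed

lemma M11_embeds: "\<exists>H. subgroup H (aut_group {1..12} blocks) \<and> (aut_group {1..12} blocks)\<lparr>carrier := H\<rparr> \<cong> M11"
proof -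
  let ?G = "aut_group {1..12} blocks"
  \<comment> \<open>By \<open>compatible_left_unique\<close> the lift is unique on
    \<open>M11\<close>, so nothing depends on the choice.\<close>
  define lift where "lift g = (SOME h. compatible h g)" for g
  have lift: "compatible (lift g) g" if "g \<in> carrier M11" for g
    unfolding lift_def using M11_compatible [OF that] by (rule someI_ex)
  have mult: "x \<otimes>\<^bsub>M11\<^esub> y = x \<circ> y" "x \<otimes>\<^bsub>?G\<^esub> y = x \<circ> y" for x y
    by (simp_all add: M11_def sym_group_def aut_group_def)
  have "lift \<in> hom M11 ?G"
  proof (rule homI)
    show "lift x \<in> carrier ?G" if "x \<in> carrier M11" for x
      using lift [OF that] by (rule compatible_in_aut_group)
    show "lift (x \<otimes>\<^bsub>M11\<^esub> y) = lift x \<otimes>\<^bsub>?G\<^esub> lift y"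
      if "x \<in> carrier M11" "y \<in> carrier M11" for x y
    proof -
      have "x \<otimes>\<^bsub>M11\<^esub> y \<in> carrier M11"
        by (rule monoid.m_closed [OF group.is_monoid [OF M11_is_group] that])
      then have "compatible (lift (x \<circ> y)) (x \<circ> y)"
        unfolding mult by (rule lift)
      \<comment> \<open>Both sides are lifts of \<open>x \<circ> y\<close>.\<close>
      then show ?thesis
        unfolding mult
        by (rule compatible_left_unique [OF _ compatible_comp [OF lift [OF that(1)] lift [OF that(2)]]])
    qed
  qed
  then interpret group_hom M11 ?G lift
    by (intro group_hom.intro M11_is_group aut_group_is_group group_hom_axioms.intro)
  have "inj_on lift (carrier M11)"
    using lift compatible_right_unique by (metis inj_onI)
  \<comment> \<open>An injective homomorphism is an isomorphism onto its image, and this image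
    serves as \<open>H\<close>.\<close>
  then have "lift \<in> iso M11 (?G\<lparr>carrier := lift ` carrier M11\<rparr>)"
    using homh by (auto simp: iso_def hom_def bij_betw_def)
  then have "?G\<lparr>carrier := lift ` carrier M11\<rparr> \<cong> M11"
    using G.iso_sym is_isoI by blast
  then show ?thesis
    using img_is_subgroup by blast
qed

theorem theorem1p3:
  shows "\<exists>(V :: nat set) (E :: nat set set).
    is_design 3 12 4 3 V E \<and>
    (\<forall>X. X \<subseteq> V \<and> card X = 5 \<longrightarrow> card (spanned E X) = 0 \<or> card (spanned E X) = 2) \<and>
    card E = 165 \<and>
    three_transitive V E \<and>
    (\<exists>H. subgroup H (aut_group V E) \<and> (aut_group V E)\<lparr>carrier := H\<rparr> \<cong> M11)"
  using is_design_blocks card_spanned_five card_blocks three_transitive_blocks M11_embeds by blast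

end
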